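(* Let $G$ be a group with a finite symmetrized presentation $\mathcal P$, Cayley complex $X$, and combed filling $\mathcal D$. Suppose that $j:\mathbb N\to\mathbb N$ is a nondecreasing function such that for every vertex $v$ of a van Kampen diagram $\Delta$ in $\mathcal D$, $$d_\Delta( *,v)\le j(d_X(\epsilon,\pi_\Delta(v))),$$ and let $\tilde j:\mathbb N[\tfrac14]\to\mathbb N[\tfrac14]$ be defined by $\tilde j(n):=j(\lceil n\rceil)+1$. (1) If $G$ satisfies an extrinsic tame filling inequality for the function $f$ with respect to $\mathcal D$, then $G$ satisfies an intrinsic tame filling inequality for the function $\tilde j\circ f$. (2) If $G$ satisfies an intrinsic tame filling inequality for the function $f$ with respect to $\mathcal D$, then $G$ satisfies an extrinsic tame filling inequality for the function $f\circ\tilde j$. Here $f:\mathbb N[\tfrac14]\to\mathbb N[\tfrac14]$ is nondecreasing and all inequalities are over $\mathcal P$.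
   Context: Conventions. $\mathbb N$ includes $0$, and $\mathbb N[\frac14]=\{0,\frac14,\frac12,\frac34,1,\dots\}$ is the set of nonnegative integer multiples of $\frac14$. $A$ is a finite symmetric (inverse-closed) generating set of $G$, no element of which represents the identity $\epsilon$; $A^*$ is the set of words over $A$, $l(w)$ is the length of $w$, and $=_G$ denotes equality in $G$. A presentation $\mathcal P=\langle A\mid R\rangle$ is symmetrized: $R$ is a set of nonempty words over $A$ closed under inversion and cyclic conjugation, and containing the freely reduced form of each of its elements unless that form is empty. $X$ is the Cayley 2-complex of $\mathcal P$, whose 1-skeleton $X^1$ is the Cayley graph (the directed edges labeled $a$ from $g$ to $ga$ and $a^{-1}$ from $ga$ to $g$ have the same underlying undirected edge); $d_X$ is the path metric on $X^1$. A van Kampen diagram over $\mathcal P$ for $w\in A^*$ with $w=_G\epsilon$ is a finite, planar, contractible combinatorial 2-complex $\Delta$ with edges directed and labeled by $A$, whose boundary is an edge path labeled $w$ starting at a basepoint vertex $*$ and reading counterclockwise, every 2-cell having boundary labeled by an element of $R$ (not necessarily reduced). $d_\Delta$ is the path metric on $\Delta^1$, and $\pi_\Delta:\Delta\to X$ is the canonical cellular map with $\pi_\Delta( * )=\epsilon$ preserving edge labels and directions. Coarse distance: for a combinatorial 2-complex $Y$ with basepoint vertex $y$ and a point $p\in Y$: $\tilde d_Y(y,p):=d_Y(y,p)$ (path metric in $Y^1$) if $p$ is a vertex; $\tilde d_Y(y,p):=\min\{\tilde d_Y(y,v)\mid v\in\partial e\}+\frac12$ if $p$ is in the interior of an edge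 $e$; $\tilde d_Y(y,p):=\max\{\tilde d_Y(y,q)\mid q\in Int(e),\ e\text{ an edge of }\partial\sigma\}-\frac14$ if $p$ is in the interior of a 2-cell $\sigma$. A van Kampen homotopy of $\Delta$ is a continuous $\Psi:\partial\Delta\times[0,1]\to\Delta$ with $\Psi(p,0)=*$ and $\Psi(p,1)=p$ for all $p\in\partial\Delta$; $\Psi( *,t)=*$ for all $t$; and $\Psi(p,t)\in\Delta^1$ for all $t$ whenever $p$ is a vertex of $\partial\Delta$. A combed filling for $(G,\mathcal P)$ is a collection $\{(\Delta_w,\Psi_w)\mid w\in A^*,w=_G\epsilon\}$ where $\Delta_w$ is a van Kampen diagram for $w$ and $\Psi_w$ is a van Kampen homotopy of $\Delta_w$. $(G,\mathcal P)$ satisfies an intrinsic [resp. extrinsic] tame filling inequality for a nondecreasing $f:\mathbb N[\frac14]\to\mathbb N[\frac14]$ with respect to a combed filling $\mathcal D$ if for all $(\Delta,\Psi)\in\mathcal D$, $p\in\partial\Delta$, $0\le s<t\le1$: $\tilde d_\Delta( *,\Psi(p,s))\le f(\tilde d_\Delta( *,\Psi(p,t)))$ [resp. $\tilde d_X(\epsilon,\pi_\Delta(\Psi(p,s)))\le f(\tilde d_X(\epsilon,\pi_\Delta(\Psi(p,t))))$]. It satisfies the inequality (without reference to $\mathcal D$) if it does so with respect to some combed filling. *)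

theory Defs
  imports "HOL-Complex_Analysis.Complex_Analysis" "HOL-Algebra.Generated_Groups"
begin

section \<open>Combinatorial 2-complexes\<close>

text \<open>
  A complex is given by its characteristic maps. Edges are directed: the set of edges contains
  with every map \<open>e\<close> on the unit interval also the reversed map, and the two have the same
  underlying undirected edge. A 2-cell is a map on the closed unit disc. Only the values on the
  unit interval, respectively on the closed unit disc, matter.
\<close>

record 'p complex2 =
  verts :: "'p set"
  edges :: "(real \<Rightarrow> 'p) set"
  faces :: "(complex \<Rightarrow> 'p) set"

definition rev_edge :: "(real \<Rightarrow> 'p) \<Rightarrow> real \<Rightarrow> 'p" where
  "rev_edge e = (\<lambda>t. e (1 - t))"

definition open_edge :: "(real \<Rightarrow> 'p) \<Rightarrow> 'p set" where
  "open_edge e = e ` {0<..<1}"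

definition open_face :: "(complex \<Rightarrow> 'p) \<Rightarrow> 'p set" where
  "open_face \<Phi> = \<Phi> ` ball 0 1"

definition skeleton1 :: "('p, 'z) complex2_scheme \<Rightarrow> 'p set" where
  "skeleton1 Y = verts Y \<union> (\<Union>e\<in>edges Y. open_edge e)"

definition points :: "('p, 'z) complex2_scheme \<Rightarrow> 'p set" where
  "points Y = skeleton1 Y \<union> (\<Union>\<Phi>\<in>faces Y. open_face \<Phi>)"

text \<open>
  Going once around the unit circle counterclockwise from 1, the map runs through the given
  directed edges one after the other, each on an arc of the same length.
\<close>

definition traces :: "(complex \<Rightarrow> 'p) \<Rightarrow> (real \<Rightarrow> 'p) list \<Rightarrow> bool" where
  "traces \<Phi> es \<longleftrightarrow> (\<forall>k<length es. \<forall>t\<in>{0..1}.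
     \<Phi> (cis (2 * pi * (real k + t) / real (length es))) = (es ! k) t)"

definition face_boundary ::
    "('p, 'z) complex2_scheme \<Rightarrow> (complex \<Rightarrow> 'p) \<Rightarrow> (real \<Rightarrow> 'p) list \<Rightarrow> bool" where
  "face_boundary Y \<Phi> es \<longleftrightarrow> es \<noteq> [] \<and> set es \<subseteq> edges Y \<and> traces \<Phi> es"

definition combinatorial_complex :: "('p, 'z) complex2_scheme \<Rightarrow> bool" where
  "combinatorial_complex Y \<longleftrightarrow>
     (\<forall>e\<in>edges Y. e 0 \<in> verts Y \<and> e 1 \<in> verts Y \<and> rev_edge e \<in> edges Y
        \<and> inj_on e {0<..<1} \<and> open_edge e \<inter> verts Y = {}) \<and>
     (\<forall>e\<in>edges Y. \<forall>e'\<in>edges Y.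
        open_edge e \<inter> open_edge e' \<noteq> {} \<longrightarrow> e' = e \<or> e' = rev_edge e) \<and>
     (\<forall>\<Phi>\<in>faces Y. inj_on \<Phi> (ball 0 1) \<and> open_face \<Phi> \<inter> skeleton1 Y = {}
        \<and> (\<exists>es. face_boundary Y \<Phi> es)) \<and>
     (\<forall>\<Phi>\<in>faces Y. \<forall>\<Phi>'\<in>faces Y. open_face \<Phi> \<inter> open_face \<Phi>' \<noteq> {} \<longrightarrow> \<Phi>' = \<Phi>)"

text \<open>The weak topology: a set is open iff its preimages under all characteristic maps are.\<close>

definition cw_open :: "('p, 'z) complex2_scheme \<Rightarrow> 'p set \<Rightarrow> bool" where
  "cw_open Y U \<longleftrightarrow> U \<subseteq> points Y \<and>
     (\<forall>e\<in>edges Y. openin (top_of_set {0..1}) {t\<in>{0..1}. e t \<in> U}) \<and>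
     (\<forall>\<Phi>\<in>faces Y. openin (top_of_set (cball 0 1)) {z\<in>cball 0 1. \<Phi> z \<in> U})"

definition cw_topology :: "('p, 'z) complex2_scheme \<Rightarrow> 'p topology" where
  "cw_topology Y = topology (cw_open Y)"

lemma openin_cw_topology: "openin (cw_topology Y) U \<longleftrightarrow> cw_open Y U"
proof -
  have "istopology (cw_open Y)"
    unfolding istopology_def
  proof (intro conjI allI impI)
    fix S T assume S: "cw_open Y S" and T: "cw_open Y T"
    have "{t\<in>{0..1}. e t \<in> S \<inter> T} = {t\<in>{0..1}. e t \<in> S} \<inter> {t\<in>{0..1}. e t \<in> T}"
      for e :: "real \<Rightarrow> 'a" by auto
    moreover have "{z\<in>cball 0 1. \<Phi> z \<in> S \<inter> T} =
        {z\<in>cball 0 1. \<Phi> z \<in> S} \<inter> {z\<in>cball 0 1. \<Phi> z \<in> T}"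
      for \<Phi> :: "complex \<Rightarrow> 'a" by auto
    ultimately show "cw_open Y (S \<inter> T)"
      using S T unfolding cw_open_def by (auto intro: openin_Int)
  next
    fix K assume K: "\<forall>U\<in>K. cw_open Y U"
    have sub: "\<Union>K \<subseteq> points Y"
      using K by (auto simp: cw_open_def)
    have e: "{t\<in>{0..1}. e t \<in> \<Union>K} = (\<Union>U\<in>K. {t\<in>{0..1}. e t \<in> U})"
      for e :: "real \<Rightarrow> 'a" by auto
    have \<Phi>: "{z\<in>cball 0 1. \<Phi> z \<in> \<Union>K} = (\<Union>U\<in>K. {z\<in>cball 0 1. \<Phi> z \<in> U})"
      for \<Phi> :: "complex \<Rightarrow> 'a" by auto
    show "cw_open Y (\<Union>K)"
      unfolding cw_open_def e \<Phi>
      by (intro conjI ballI sub openin_Union) (use K in \<open>auto simp only: cw_open_def image_iff\<close>)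
  qed
  then show ?thesis
    by (simp add: cw_topology_def topology_inverse')
qed

section \<open>Distances\<close>

fun edge_path :: "('p, 'z) complex2_scheme \<Rightarrow> 'p \<Rightarrow> (real \<Rightarrow> 'p) list \<Rightarrow> 'p \<Rightarrow> bool" where
  "edge_path Y u [] v \<longleftrightarrow> u = v"
| "edge_path Y u (e # es) v \<longleftrightarrow> e \<in> edges Y \<and> e 0 = u \<and> edge_path Y (e 1) es v"

text \<open>The path metric of the 1-skeleton (edges have length 1), restricted to vertices in the same
  component.\<close>

definition vdist :: "('p, 'z) complex2_scheme \<Rightarrow> 'p \<Rightarrow> 'p \<Rightarrow> nat" where
  "vdist Y u v = (LEAST n. \<exists>es. edge_path Y u es v \<and> length es = n)"

definition coarse_dist1 :: "('p, 'z) complex2_scheme \<Rightarrow> 'p \<Rightarrow> 'p \<Rightarrow> real" where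
  "coarse_dist1 Y y p =
     (if p \<in> verts Y then real (vdist Y y p)
      else Min {real (vdist Y y v) | v. \<exists>e\<in>edges Y. p \<in> open_edge e \<and> v \<in> {e 0, e 1}} + 1/2)"

definition coarse_dist :: "('p, 'z) complex2_scheme \<Rightarrow> 'p \<Rightarrow> 'p \<Rightarrow> real" where
  "coarse_dist Y y p =
     (if p \<in> skeleton1 Y then coarse_dist1 Y y p
      else Max {coarse_dist1 Y y q | q. \<exists>\<Phi>\<in>faces Y. \<exists>es. \<exists>e\<in>set es.
             p \<in> open_face \<Phi> \<and> face_boundary Y \<Phi> es \<and> q \<in> open_edge e} - 1/4)"

section \<open>Words and presentations\<close>

definition word_value :: "('g, 'b) monoid_scheme \<Rightarrow> 'g list \<Rightarrow> 'g" where
  "word_value G w = foldr (\<otimes>\<^bsub>G\<^esub>) w \<one>\<^bsub>G\<^esub>"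

definition word_inv :: "('g, 'b) monoid_scheme \<Rightarrow> 'g list \<Rightarrow> 'g list" where
  "word_inv G w = rev (map (\<lambda>a. inv\<^bsub>G\<^esub> a) w)"

definition null_words :: "('g, 'b) monoid_scheme \<Rightarrow> 'g set \<Rightarrow> 'g list set" where
  "null_words G A = {w \<in> lists A. word_value G w = \<one>\<^bsub>G\<^esub>}"

definition deletes :: "'g set \<Rightarrow> 'g list set \<Rightarrow> 'g list \<Rightarrow> 'g list \<Rightarrow> bool" where
  "deletes A S x y \<longleftrightarrow> (\<exists>u\<in>lists A. \<exists>v\<in>lists A. \<exists>s\<in>S. x = u @ s @ v \<and> y = u @ v)"

definition cancelling_pairs :: "('g, 'b) monoid_scheme \<Rightarrow> 'g set \<Rightarrow> 'g list set" where
  "cancelling_pairs G A = {[a, inv\<^bsub>G\<^esub> a] | a. a \<in> A}"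

definition freely_reduces_to :: "('g, 'b) monoid_scheme \<Rightarrow> 'g set \<Rightarrow> 'g list \<Rightarrow> 'g list \<Rightarrow> bool" where
  "freely_reduces_to G A w r \<longleftrightarrow>
     (deletes A (cancelling_pairs G A))\<^sup>*\<^sup>* w r \<and> (\<nexists>y. deletes A (cancelling_pairs G A) r y)"

text \<open>
  The formal inverse of the letter \<open>a\<close> is the letter \<open>a\<inverse>\<close> of \<open>A\<close>. The last condition says that
  the group is the one defined by the generators \<open>A\<close> and relators \<open>R\<close>.
\<close>

definition finite_symmetrized_presentation ::
    "('g, 'b) monoid_scheme \<Rightarrow> 'g set \<Rightarrow> 'g list set \<Rightarrow> bool" where
  "finite_symmetrized_presentation G A R \<longleftrightarrow>
     finite A \<and> A \<subseteq> carrier G \<and> generate G A = carrier G \<and>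
     (\<forall>a\<in>A. inv\<^bsub>G\<^esub> a \<in> A) \<and> \<one>\<^bsub>G\<^esub> \<notin> A \<and>
     finite R \<and> R \<subseteq> lists A \<and> [] \<notin> R \<and>
     (\<forall>r\<in>R. word_inv G r \<in> R) \<and>
     (\<forall>r\<in>R. \<forall>n. rotate n r \<in> R) \<and>
     (\<forall>r\<in>R. \<forall>s. freely_reduces_to G A r s \<and> s \<noteq> [] \<longrightarrow> s \<in> R) \<and>
     (\<forall>w\<in>lists A. word_value G w = \<one>\<^bsub>G\<^esub> \<longleftrightarrow> equivclp (deletes A (cancelling_pairs G A \<union> R)) w [])"

section \<open>The Cayley 2-complex\<close>

text \<open>
  A point in the interior of an edge is represented by its coordinates with respect to both
  directions of that edge.
\<close>

datatype 'g cayley_point =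
    Vertex 'g
  | Edge_Point "('g \<times> 'g \<times> real) set"
  | Face_Point 'g "'g list" complex

definition cayley_edge :: "('g, 'b) monoid_scheme \<Rightarrow> 'g \<Rightarrow> 'g \<Rightarrow> real \<Rightarrow> 'g cayley_point" where
  "cayley_edge G g a t =
     (if t \<le> 0 then Vertex g
      else if t \<ge> 1 then Vertex (g \<otimes>\<^bsub>G\<^esub> a)
      else Edge_Point {(g, a, t), (g \<otimes>\<^bsub>G\<^esub> a, inv\<^bsub>G\<^esub> a, 1 - t)})"

text \<open>The 2-cell attached at \<open>g\<close> along the loop labelled \<open>r\<close>: the point of the circle at angle
  \<open>2\<pi>x/n\<close>, where \<open>n\<close> is the length of \<open>r\<close>, is sent to the point of the loop at distance \<open>x\<close>
  from \<open>g\<close>.\<close>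

definition cayley_face ::
    "('g, 'b) monoid_scheme \<Rightarrow> 'g \<Rightarrow> 'g list \<Rightarrow> complex \<Rightarrow> 'g cayley_point" where
  "cayley_face G g r z =
     (if norm z < 1 then Face_Point g r z
      else let x = real (length r) * Arg2pi z / (2 * pi); k = nat \<lfloor>x\<rfloor>
           in cayley_edge G (g \<otimes>\<^bsub>G\<^esub> word_value G (take k r)) (r ! k) (frac x))"

definition cayley_complex ::
    "('g, 'b) monoid_scheme \<Rightarrow> 'g set \<Rightarrow> 'g list set \<Rightarrow> 'g cayley_point complex2" where
  "cayley_complex G A R =
     \<lparr> verts = Vertex ` carrier G,
       edges = {cayley_edge G g a | g a. g \<in> carrier G \<and> a \<in> A},
       faces = {cayley_face G g r | g r. g \<in> carrier G \<and> r \<in> R} \<rparr>"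

section \<open>Van Kampen diagrams\<close>

record 'g diagram = "complex complex2" +
  base :: complex
  label :: "(real \<Rightarrow> complex) \<Rightarrow> 'g"

definition diagram_boundary :: "('g, 'z) diagram_scheme \<Rightarrow> complex set" where
  "diagram_boundary \<Delta> = frontier (points \<Delta>)"

text \<open>
  The complement of a diagram in the sphere is an open 2-cell, and the boundary path of the
  diagram is the attaching map of this 2-cell. The winding number distinguishes the
  counterclockwise from the clockwise boundary path.
\<close>

definition ccw_boundary_path :: "('g, 'z) diagram_scheme \<Rightarrow> (real \<Rightarrow> complex) list \<Rightarrow> bool" where
  "ccw_boundary_path \<Delta> es \<longleftrightarrow> set es \<subseteq> edges \<Delta> \<and>
     (\<exists>\<Phi> \<Phi>'. continuous_on (- ball 0 1) \<Phi> \<and>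
        homeomorphism (- cball 0 1) (- points \<Delta>) \<Phi> \<Phi>' \<and>
        winding_number (\<Phi> \<circ> circlepath 0 2) (base \<Delta>) = 1 \<and>
        \<Phi> 1 = base \<Delta> \<and> traces \<Phi> es \<and> (es = [] \<longrightarrow> (\<forall>z\<in>sphere 0 1. \<Phi> z = base \<Delta>)))"

text \<open>
  Planarity: the complex is a subset of the plane, and its topology is the one induced by the
  plane. Reading a directed edge backwards gives the inverse label.
\<close>

definition van_kampen_diagram ::
    "('g, 'b) monoid_scheme \<Rightarrow> 'g set \<Rightarrow> 'g list set \<Rightarrow> 'g list \<Rightarrow> 'g diagram \<Rightarrow> bool" where
  "van_kampen_diagram G A R w \<Delta> \<longleftrightarrow>
     combinatorial_complex \<Delta> \<and>
     finite (verts \<Delta>) \<and> finite (edges \<Delta>) \<and> finite (faces \<Delta>) \<and>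
     cw_topology \<Delta> = top_of_set (points \<Delta>) \<and>
     contractible (points \<Delta>) \<and>
     base \<Delta> \<in> verts \<Delta> \<and>
     (\<forall>e\<in>edges \<Delta>. label \<Delta> e \<in> A \<and> label \<Delta> (rev_edge e) = inv\<^bsub>G\<^esub> label \<Delta> e) \<and>
     (\<forall>\<Phi>\<in>faces \<Delta>. \<exists>es. face_boundary \<Delta> \<Phi> es \<and> map (label \<Delta>) es \<in> R) \<and>
     (\<exists>es. ccw_boundary_path \<Delta> es \<and> map (label \<Delta>) es = w)"

text \<open>
  The canonical map to the Cayley complex. It carries every edge to the edge with the same label
  and direction, and every 2-cell to a 2-cell (the Cayley complex of a symmetrized presentation
  has a 2-cell whose attaching path starts at the image of the point 1 of the unit circle and
  spells the boundary label read from there). Such a map exists for every diagram and is unique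
  on the 1-skeleton; the coarse distance of the image of a point in a 2-cell depends only on the
  boundary of that 2-cell.
\<close>

definition canonical_map ::
    "('g, 'b) monoid_scheme \<Rightarrow> 'g set \<Rightarrow> 'g list set \<Rightarrow> 'g diagram \<Rightarrow>
     (complex \<Rightarrow> 'g cayley_point) \<Rightarrow> bool" where
  "canonical_map G A R \<Delta> \<pi> \<longleftrightarrow>
     continuous_map (cw_topology \<Delta>) (cw_topology (cayley_complex G A R)) \<pi> \<and>
     \<pi> (base \<Delta>) = Vertex \<one>\<^bsub>G\<^esub> \<and>
     (\<forall>e\<in>edges \<Delta>. \<exists>g\<in>carrier G. \<forall>t\<in>{0..1}. \<pi> (e t) = cayley_edge G g (label \<Delta> e) t) \<and>
     (\<forall>\<Phi>\<in>faces \<Delta>. \<exists>g\<in>carrier G. \<exists>r\<in>R. \<forall>z\<in>cball 0 1. \<pi> (\<Phi> z) = cayley_face G g r z)"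

definition van_kampen_homotopy :: "'g diagram \<Rightarrow> (complex \<times> real \<Rightarrow> complex) \<Rightarrow> bool" where
  "van_kampen_homotopy \<Delta> \<Psi> \<longleftrightarrow>
     continuous_on (diagram_boundary \<Delta> \<times> {0..1}) \<Psi> \<and>
     \<Psi> ` (diagram_boundary \<Delta> \<times> {0..1}) \<subseteq> points \<Delta> \<and>
     (\<forall>p\<in>diagram_boundary \<Delta>. \<Psi> (p, 0) = base \<Delta> \<and> \<Psi> (p, 1) = p) \<and>
     (\<forall>t\<in>{0..1}. \<Psi> (base \<Delta>, t) = base \<Delta>) \<and>
     (\<forall>p\<in>diagram_boundary \<Delta> \<inter> verts \<Delta>. \<forall>t\<in>{0..1}. \<Psi> (p, t) \<in> skeleton1 \<Delta>)"

section \<open>Tame filling inequalities\<close>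

text \<open>A diagram with a van Kampen homotopy, together with the canonical map of the diagram.\<close>

record 'g combed_diagram =
  diag :: "'g diagram"
  htpy :: "complex \<times> real \<Rightarrow> complex"
  proj :: "complex \<Rightarrow> 'g cayley_point"

definition combed_filling ::
    "('g, 'b) monoid_scheme \<Rightarrow> 'g set \<Rightarrow> 'g list set \<Rightarrow> ('g list \<Rightarrow> 'g combed_diagram) \<Rightarrow> bool" where
  "combed_filling G A R D \<longleftrightarrow> (\<forall>w\<in>null_words G A.
     van_kampen_diagram G A R w (diag (D w)) \<and>
     van_kampen_homotopy (diag (D w)) (htpy (D w)) \<and>
     canonical_map G A R (diag (D w)) (proj (D w)))"

definition diagram_coarse_dist :: "'g diagram \<Rightarrow> complex \<Rightarrow> real" where
  "diagram_coarse_dist \<Delta> p = coarse_dist \<Delta> (base \<Delta>) p"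

definition cayley_coarse_dist ::
    "('g, 'b) monoid_scheme \<Rightarrow> 'g set \<Rightarrow> 'g list set \<Rightarrow> 'g cayley_point \<Rightarrow> real" where
  "cayley_coarse_dist G A R p = coarse_dist (cayley_complex G A R) (Vertex \<one>\<^bsub>G\<^esub>) p"

definition quarter_nats :: "real set" where
  "quarter_nats = range (\<lambda>n::nat. real n / 4)"

definition nondecreasing_quarter :: "(real \<Rightarrow> real) \<Rightarrow> bool" where
  "nondecreasing_quarter f \<longleftrightarrow> f \<in> quarter_nats \<rightarrow> quarter_nats \<and> mono_on quarter_nats f"

definition intrinsic_tame_wrt ::
    "('g, 'b) monoid_scheme \<Rightarrow> 'g set \<Rightarrow> ('g list \<Rightarrow> 'g combed_diagram) \<Rightarrow> (real \<Rightarrow> real) \<Rightarrow> bool" where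
  "intrinsic_tame_wrt G A D f \<longleftrightarrow> nondecreasing_quarter f \<and>
     (\<forall>w\<in>null_words G A. \<forall>p\<in>diagram_boundary (diag (D w)). \<forall>s t. 0 \<le> s \<and> s < t \<and> t \<le> 1 \<longrightarrow>
        diagram_coarse_dist (diag (D w)) (htpy (D w) (p, s))
          \<le> f (diagram_coarse_dist (diag (D w)) (htpy (D w) (p, t))))"

definition extrinsic_tame_wrt ::
    "('g, 'b) monoid_scheme \<Rightarrow> 'g set \<Rightarrow> 'g list set \<Rightarrow> ('g list \<Rightarrow> 'g combed_diagram) \<Rightarrow>
     (real \<Rightarrow> real) \<Rightarrow> bool" where
  "extrinsic_tame_wrt G A R D f \<longleftrightarrow> nondecreasing_quarter f \<and>
     (\<forall>w\<in>null_words G A. \<forall>p\<in>diagram_boundary (diag (D w)). \<forall>s t. 0 \<le> s \<and> s < t \<and> t \<le> 1 \<longrightarrow>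
        cayley_coarse_dist G A R (proj (D w) (htpy (D w) (p, s)))
          \<le> f (cayley_coarse_dist G A R (proj (D w) (htpy (D w) (p, t)))))"

definition intrinsic_tame ::
    "('g, 'b) monoid_scheme \<Rightarrow> 'g set \<Rightarrow> 'g list set \<Rightarrow> (real \<Rightarrow> real) \<Rightarrow> bool" where
  "intrinsic_tame G A R f \<longleftrightarrow> (\<exists>D. combed_filling G A R D \<and> intrinsic_tame_wrt G A D f)"

definition extrinsic_tame ::
    "('g, 'b) monoid_scheme \<Rightarrow> 'g set \<Rightarrow> 'g list set \<Rightarrow> (real \<Rightarrow> real) \<Rightarrow> bool" where
  "extrinsic_tame G A R f \<longleftrightarrow> (\<exists>D. combed_filling G A R D \<and> extrinsic_tame_wrt G A R D f)"

definition j_tilde :: "(nat \<Rightarrow> nat) \<Rightarrow> real \<Rightarrow> real" where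
  "j_tilde j x = real (j (nat \<lceil>x\<rceil>)) + 1"

end

theory Submission
  imports Defs
begin

text \<open>
  The canonical map sends edge paths to edge paths and closed cells onto closed cells, and the
  coarse distance of a point is computed from the vertices of its closed cell by minima and maxima.
  Hence the coarse distance in the Cayley complex is at most that in the diagram, and the
  hypothesis on \<open>j\<close> at the vertices bounds the latter by \<open>j_tilde j\<close> of the former at all
  points. Both claims follow, with the same combed filling, by composing these two bounds.
\<close>

section \<open>Combinatorial complexes\<close>

text \<open>The main obstacle is that \<open>vdist\<close> is a \<open>LEAST\<close>, hence
  unspecified between vertices that no edge path joins. A path in the diagram has to be produced
  first, and its source is topological: a contractible diagram is connected, and connectedness in
  the weak topology yields edge paths. A second obstacle is that the coarse distance in a 2-cell is
  a \<open>Max\<close> over infinitely many points and over all boundary paths of the cell; its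
  value set must be shown finite and independent of the path. The ceiling in \<open>j_tilde\<close>
  turns a coarse distance of m + 1/4 or m + 1/2 into a natural argument that is at least m, and the
  summand 1 covers the 1/2 by which an edge exceeds its nearer endpoint.\<close>

lemma rev_edge_rev_edge [simp]: "rev_edge (rev_edge e) = e"
  by (simp add: rev_edge_def)

lemma rev_edge_0 [simp]: "rev_edge e 0 = e 1"
  and rev_edge_1 [simp]: "rev_edge e 1 = e 0"
  by (simp_all add: rev_edge_def)

lemma open_edge_rev_edge [simp]: "open_edge (rev_edge e) = open_edge e"
proof -
  have "open_edge (rev_edge e) \<subseteq> open_edge e" for e :: "real \<Rightarrow> 'a"
  proof
    fix p assume "p \<in> open_edge (rev_edge e)"
    then obtain t where "0 < t" "t < 1" "p = e (1 - t)"
      by (auto simp: open_edge_def rev_edge_def)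
    then show "p \<in> open_edge e"
      unfolding open_edge_def by (intro image_eqI[of _ _ "1 - t"]) auto
  qed
  from this[of e] this[of "rev_edge e"] show ?thesis by auto
qed

lemma open_edgeI: "0 < t \<Longrightarrow> t < 1 \<Longrightarrow> e t \<in> open_edge e"
  by (simp add: open_edge_def)

lemma complex_edgeD:
  assumes "combinatorial_complex Y" "e \<in> edges Y"
  shows "e 0 \<in> verts Y" "e 1 \<in> verts Y" "rev_edge e \<in> edges Y" "open_edge e \<inter> verts Y = {}"
  using assms by (simp_all add: combinatorial_complex_def)

lemma complex_edge_eq:
  assumes "combinatorial_complex Y" "e \<in> edges Y" "e' \<in> edges Y"
    and "p \<in> open_edge e" "p \<in> open_edge e'"
  shows "e' = e \<or> e' = rev_edge e"
proof -
  have "\<forall>e\<in>edges Y. \<forall>e'\<in>edges Y. open_edge e \<inter> open_edge e' \<noteq> {} \<longrightarrow> e' = e \<or> e' = rev_edge e"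
    using assms(1) unfolding combinatorial_complex_def by (elim conjE)
  moreover have "open_edge e \<inter> open_edge e' \<noteq> {}"
    using assms(4,5) by blast
  ultimately show ?thesis
    using assms(2,3) by simp
qed

lemma complex_faceD:
  assumes "combinatorial_complex Y" "\<Phi> \<in> faces Y"
  shows "open_face \<Phi> \<inter> skeleton1 Y = {}" "\<exists>es. face_boundary Y \<Phi> es"
  using assms by (simp_all add: combinatorial_complex_def)

lemma complex_face_eq:
  assumes "combinatorial_complex Y" "\<Phi> \<in> faces Y" "\<Phi>' \<in> faces Y"
    and "p \<in> open_face \<Phi>" "p \<in> open_face \<Phi>'"
  shows "\<Phi>' = \<Phi>"
proof -
  have "\<forall>\<Phi>\<in>faces Y. \<forall>\<Phi>'\<in>faces Y. open_face \<Phi> \<inter> open_face \<Phi>' \<noteq> {} \<longrightarrow> \<Phi>' = \<Phi>"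
    using assms(1) unfolding combinatorial_complex_def by (elim conjE)
  moreover have "open_face \<Phi> \<inter> open_face \<Phi>' \<noteq> {}"
    using assms(4,5) by blast
  ultimately show ?thesis
    using assms(2,3) by simp
qed

lemma edge_in_skeleton1:
  assumes "combinatorial_complex Y" "e \<in> edges Y" "t \<in> {0..1}"
  shows "e t \<in> skeleton1 Y"
proof -
  consider "t = 0" | "t = 1" | "0 < t" "t < 1"
    using assms(3) by fastforce
  then show ?thesis
    by cases (use complex_edgeD[OF assms(1,2)] assms(2) open_edgeI[of t e] in \<open>auto simp: skeleton1_def\<close>)
qed

text \<open>Measure the argument of \<open>z\<close> in arcs: its integer part selects the arc and
  its fractional part the position on it. Since \<open>t < 1\<close>, a point of the boundary is
  either the start of its edge or in the open edge.\<close>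

lemma sphere_arc:
  assumes "norm z = 1" "0 < n"
  obtains k t where "k < n" "0 \<le> t" "t < 1" "z = cis (2 * pi * (real k + t) / real n)"
proof -
  define x where "x = real n * Arg2pi z / (2 * pi)"
  have x: "0 \<le> x" "x < real n"
    using assms Arg2pi_ge_0[of z] Arg2pi_lt_2pi[of z] by (auto simp: x_def field_simps)
  define k where "k = nat \<lfloor>x\<rfloor>"
  have k: "real k = of_int \<lfloor>x\<rfloor>"
    using x by (simp add: k_def)
  have "z = cis (Arg2pi z)"
    using assms Arg2pi_eq[of z] by (simp add: cis_conv_exp)
  also have "Arg2pi z = 2 * pi * (real k + frac x) / real n"
    using assms(2) by (simp add: k frac_def x_def field_simps)
  finally have "z = cis (2 * pi * (real k + frac x) / real n)" .
  moreover have "k < n"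
    using x k by linarith
  ultimately show thesis
    using that[of k "frac x"] frac_lt_1[of x] by auto
qed

lemma face_boundary_arc:
  assumes "face_boundary Y \<Phi> es" "norm z = 1"
  obtains e t where "e \<in> set es" "0 \<le> t" "t < 1" "\<Phi> z = e t"
proof -
  from assms(1) have "0 < length es" by (simp add: face_boundary_def)
  with assms(2) obtain k t where kt: "k < length es" "0 \<le> t" "t < 1"
    "z = cis (2 * pi * (real k + t) / real (length es))"
    by (rule sphere_arc)
  with assms(1) have "\<Phi> z = (es ! k) t"
    by (auto simp: face_boundary_def traces_def)
  with kt show thesis by (intro that[of "es ! k" t]) simp_all
qed

text \<open>The right-hand side does not mention \<open>es\<close>, so any two boundary paths of a
  2-cell cover the same open edges. This makes the coarse distance in a 2-cell computable from a
  single path.\<close>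

lemma open_edges_face_boundary:
  assumes Y: "combinatorial_complex Y" and es: "face_boundary Y \<Phi> es"
  shows "(\<Union>e\<in>set es. open_edge e) = \<Phi> ` sphere 0 1 - verts Y"
proof (intro equalityI subsetI)
  fix q assume "q \<in> (\<Union>e\<in>set es. open_edge e)"
  then obtain k t where kt: "k < length es" "0 < t" "t < 1" "q = (es ! k) t"
    by (auto simp: open_edge_def in_set_conv_nth)
  then have "es ! k \<in> edges Y"
    using es by (auto simp: face_boundary_def)
  then have "q \<notin> verts Y"
    using complex_edgeD(4)[OF Y, of "es ! k"] open_edgeI[of t "es ! k"] kt by auto
  moreover have "q = \<Phi> (cis (2 * pi * (real k + t) / real (length es)))"
    using es kt by (auto simp: face_boundary_def traces_def)
  ultimately show "q \<in> \<Phi> ` sphere 0 1 - verts Y" by auto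
next
  fix q assume q: "q \<in> \<Phi> ` sphere 0 1 - verts Y"
  then obtain e t where e: "e \<in> set es" "0 \<le> t" "t < 1" "q = e t"
    using face_boundary_arc[OF es] by (metis DiffD1 imageE mem_sphere_0)
  have "e 0 \<in> verts Y"
    using complex_edgeD(1)[OF Y] es e by (auto simp: face_boundary_def)
  with q e have "0 < t" by (cases "t = 0") auto
  with e show "q \<in> (\<Union>e\<in>set es. open_edge e)" by (auto intro: open_edgeI)
qed

text \<open>Open sets lie in \<open>points Y\<close> by definition, so it remains to see that
  \<open>points Y\<close> is open, that is, that no characteristic map leaves it. On the unit circle
  this holds because the boundary path runs through edges.\<close>

lemma topspace_cw_topology:
  assumes Y: "combinatorial_complex Y"
  shows "topspace (cw_topology Y) = points Y"
proof -
  have "e t \<in> points Y" if "e \<in> edges Y" "t \<in> {0..1}" for e t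
    using edge_in_skeleton1[OF Y that] by (simp add: points_def)
  then have e: "{t \<in> {0..1}. e t \<in> points Y} = {0..1}" if "e \<in> edges Y" for e
    using that by auto
  have "\<Phi> z \<in> points Y" if \<Phi>: "\<Phi> \<in> faces Y" and z: "z \<in> cball 0 1" for \<Phi> z
  proof (cases "norm z < 1")
    case True
    then have "\<Phi> z \<in> open_face \<Phi>" by (simp add: open_face_def)
    with \<Phi> show ?thesis by (auto simp: points_def)
  next
    case False
    with z have "norm z = 1" by simp
    moreover obtain es where es: "face_boundary Y \<Phi> es"
      using complex_faceD(2)[OF Y \<Phi>] by blast
    ultimately obtain e t where "e \<in> set es" "0 \<le> t" "t < 1" "\<Phi> z = e t"
      using face_boundary_arc by blast
    moreover from this es have "e \<in> edges Y" by (auto simp: face_boundary_def)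
    ultimately show ?thesis
      using edge_in_skeleton1[OF Y, of e t] by (simp add: points_def)
  qed
  then have f: "{z \<in> cball 0 1. \<Phi> z \<in> points Y} = cball 0 1" if "\<Phi> \<in> faces Y" for \<Phi>
    using that by auto
  have "cw_open Y (points Y)"
    unfolding cw_open_def by (intro conjI ballI) (simp_all only: e f order_refl openin_subtopology_self)
  then have "openin (cw_topology Y) (points Y)"
    by (simp add: openin_cw_topology)
  moreover have "topspace (cw_topology Y) \<subseteq> points Y"
    using openin_topspace[of "cw_topology Y"] unfolding openin_cw_topology cw_open_def by blast
  ultimately show ?thesis
    by (intro equalityI openin_subset)
qed

section \<open>Edge paths\<close>

lemma edge_path_append:
  "edge_path Y u (es @ fs) v \<longleftrightarrow> (\<exists>w. edge_path Y u es w \<and> edge_path Y w fs v)"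
  by (induction es arbitrary: u) auto

lemma edge_path_snocI:
  "edge_path Y u es (e 0) \<Longrightarrow> e \<in> edges Y \<Longrightarrow> edge_path Y u (es @ [e]) (e 1)"
  by (auto simp: edge_path_append)

lemma vdist_le: "edge_path Y u es v \<Longrightarrow> vdist Y u v \<le> length es"
  unfolding vdist_def by (rule Least_le) blast

text \<open>The given path makes the set under \<open>LEAST\<close> nonempty, so the minimum is
  attained.\<close>

lemma vdist_edge_path:
  assumes "edge_path Y u es v"
  obtains fs where "edge_path Y u fs v" "length fs = vdist Y u v"
proof -
  have "\<exists>fs. edge_path Y u fs v \<and> length fs = vdist Y u v"
    unfolding vdist_def by (rule LeastI[of _ "length es"]) (use assms in blast)
  with that show thesis by blast
qed

text \<open>The union of the closed cells with a vertex reachable from \<open>y\<close> is open and closed.\<close>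

lemma connected_complex_edge_path:
  assumes Y: "combinatorial_complex Y" and conn: "connected_space (cw_topology Y)"
    and y: "y \<in> verts Y" and v: "v \<in> verts Y"
  shows "\<exists>es. edge_path Y y es v"
proof -
  define C where "C = {v \<in> verts Y. \<exists>es. edge_path Y y es v}"
  have step: "e 1 \<in> C" if "e \<in> edges Y" "e 0 \<in> C" for e
    using that complex_edgeD(2)[OF Y, of e] edge_path_snocI[of Y y _ e] unfolding C_def by blast
  \<comment> \<open>The converse implication is \<open>step\<close> for the reversed edge.\<close>
  have C_edge: "e 1 \<in> C \<longleftrightarrow> e 0 \<in> C" if "e \<in> edges Y" for e
    using step[of e] step[of "rev_edge e"] complex_edgeD(3)[OF Y that] that by auto
  \<comment> \<open>Reachability is constant on the vertices of a closed cell, so one marked vertex,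
    \<open>e 0\<close> or \<open>\<Phi> 1\<close>, decides whether the whole cell belongs to
    \<open>U\<close>.\<close>
  define U where "U = C \<union> (\<Union>e\<in>{e \<in> edges Y. e 0 \<in> C}. open_edge e)
    \<union> (\<Union>\<Phi>\<in>{\<Phi> \<in> faces Y. \<Phi> 1 \<in> C}. open_face \<Phi>)"
  have U_vert: "v \<in> U \<longleftrightarrow> v \<in> C" if "v \<in> verts Y" for v
  proof
    assume "v \<in> U"
    moreover have "v \<notin> open_edge e" if "e \<in> edges Y" for e
      using complex_edgeD(4)[OF Y that] \<open>v \<in> verts Y\<close> by auto
    moreover have "v \<notin> open_face \<Phi>" if "\<Phi> \<in> faces Y" for \<Phi>
      using complex_faceD(1)[OF Y that] \<open>v \<in> verts Y\<close> by (auto simp: skeleton1_def)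
    ultimately show "v \<in> C" by (auto simp: U_def)
  qed (simp add: U_def)
  have U_open_edge: "p \<in> U \<longleftrightarrow> e 0 \<in> C" if e: "e \<in> edges Y" and p: "p \<in> open_edge e" for e p
  proof
    assume "p \<in> U"
    moreover have "p \<notin> C"
      using complex_edgeD(4)[OF Y e] p by (auto simp: C_def)
    moreover have "p \<notin> open_face \<Phi>" if "\<Phi> \<in> faces Y" for \<Phi>
      using complex_faceD(1)[OF Y that] e p by (auto simp: skeleton1_def)
    ultimately obtain e' where e': "e' \<in> edges Y" "e' 0 \<in> C" "p \<in> open_edge e'"
      by (auto simp: U_def)
    from complex_edge_eq[OF Y e e'(1) p e'(3)] show "e 0 \<in> C"
      using e' C_edge[OF e] by auto
  qed (use that in \<open>auto simp: U_def\<close>)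
  have U_edge: "e t \<in> U \<longleftrightarrow> e 0 \<in> C" if e: "e \<in> edges Y" and t: "t \<in> {0..1}" for e t
  proof -
    consider "t = 0" | "t = 1" | "0 < t" "t < 1"
      using t by fastforce
    then show ?thesis
      by cases (use U_vert complex_edgeD[OF Y e] C_edge[OF e] U_open_edge[OF e] open_edgeI[of t e]
        in auto)
  qed
  have U_face: "\<Phi> z \<in> U \<longleftrightarrow> \<Phi> 1 \<in> C" if \<Phi>: "\<Phi> \<in> faces Y" and z: "z \<in> cball 0 1" for \<Phi> z
  proof (cases "norm z < 1")
    case True
    then have p: "\<Phi> z \<in> open_face \<Phi>" by (simp add: open_face_def)
    show ?thesis
    proof
      assume "\<Phi> z \<in> U"
      moreover have "\<Phi> z \<notin> skeleton1 Y"
        using complex_faceD(1)[OF Y \<Phi>] p by auto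
      ultimately obtain \<Phi>' where \<Phi>': "\<Phi>' \<in> faces Y" "\<Phi>' 1 \<in> C" "\<Phi> z \<in> open_face \<Phi>'"
        by (auto simp: U_def C_def skeleton1_def)
      then show "\<Phi> 1 \<in> C"
        using complex_face_eq[OF Y \<Phi> \<Phi>'(1) p \<Phi>'(3)] by simp
    qed (use \<Phi> p in \<open>auto simp: U_def\<close>)
  next
    case False
    with z have z1: "norm z = 1" by simp
    obtain es where es: "face_boundary Y \<Phi> es"
      using complex_faceD(2)[OF Y \<Phi>] by blast
    then have sub: "set es \<subseteq> edges Y" and ne: "0 < length es"
      and tr: "\<And>k t. k < length es \<Longrightarrow> t \<in> {0..1} \<Longrightarrow>
        \<Phi> (cis (2 * pi * (real k + t) / real (length es))) = (es ! k) t"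
      by (auto simp: face_boundary_def traces_def)
    have start: "(es ! 0) 0 = \<Phi> 1"
      using tr[of 0 0] ne by simp
    \<comment> \<open>The end of an arc and the start of the next are the same point of the circle,
      so reachability passes along the whole boundary path.\<close>
    have all: "(es ! k) 0 \<in> C \<longleftrightarrow> \<Phi> 1 \<in> C" if "k < length es" for k
      using that
    proof (induction k)
      case 0
      then show ?case by (simp add: start)
    next
      case (Suc k)
      then have "(es ! Suc k) 0 = (es ! k) 1"
        using tr[of k 1] tr[of "Suc k" 0] by (simp add: add.commute)
      moreover have "es ! k \<in> edges Y"
        using Suc.prems sub by auto
      ultimately show ?case
        using Suc C_edge by simp
    qed
    from es z1 obtain e t where e: "e \<in> set es" "0 \<le> t" "t < 1" "\<Phi> z = e t"
      by (rule face_boundary_arc)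
    then have "e 0 \<in> C \<longleftrightarrow> \<Phi> 1 \<in> C"
      using all by (auto simp: in_set_conv_nth)
    moreover have "e t \<in> U \<longleftrightarrow> e 0 \<in> C"
      using U_edge[of e t] e sub by auto
    ultimately show ?thesis by (simp add: e)
  qed
  have top: "topspace (cw_topology Y) = points Y"
    by (rule topspace_cw_topology[OF Y])
  have U_sub: "U \<subseteq> points Y"
    by (auto simp: U_def C_def points_def skeleton1_def)
  have cw_points: "cw_open Y (points Y)"
    using openin_topspace[of "cw_topology Y"] by (simp add: top openin_cw_topology)
  \<comment> \<open>By \<open>U_edge\<close> and \<open>U_face\<close> every preimage of
    \<open>U\<close> under a characteristic map is everything or nothing, so both \<open>U\<close>
    and its complement are open.\<close>
  have "cw_open Y U"
    unfolding cw_open_def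
  proof (intro conjI ballI U_sub)
    fix e assume "e \<in> edges Y"
    then have "{t \<in> {0..1}. e t \<in> U} = (if e 0 \<in> C then {0..1} else {})"
      using U_edge by auto
    then show "openin (top_of_set {0..1}) {t \<in> {0..1}. e t \<in> U}" by simp
  next
    fix \<Phi> assume "\<Phi> \<in> faces Y"
    then have "{z \<in> cball 0 1. \<Phi> z \<in> U} = (if \<Phi> 1 \<in> C then cball 0 1 else {})"
      using U_face by auto
    then show "openin (top_of_set (cball 0 1)) {z \<in> cball 0 1. \<Phi> z \<in> U}" by simp
  qed
  moreover have "cw_open Y (points Y - U)"
    unfolding cw_open_def
  proof (intro conjI ballI)
    fix e assume e: "e \<in> edges Y"
    then have "{t \<in> {0..1}. e t \<in> points Y - U} =
        (if e 0 \<in> C then {} else {t \<in> {0..1}. e t \<in> points Y})"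
      using U_edge by auto
    then show "openin (top_of_set {0..1}) {t \<in> {0..1}. e t \<in> points Y - U}"
      using cw_points e by (simp add: cw_open_def)
  next
    fix \<Phi> assume \<Phi>: "\<Phi> \<in> faces Y"
    then have "{z \<in> cball 0 1. \<Phi> z \<in> points Y - U} =
        (if \<Phi> 1 \<in> C then {} else {z \<in> cball 0 1. \<Phi> z \<in> points Y})"
      using U_face by auto
    then show "openin (top_of_set (cball 0 1)) {z \<in> cball 0 1. \<Phi> z \<in> points Y - U}"
      using cw_points \<Phi> by (simp add: cw_open_def)
  qed blast
  ultimately have "closedin (cw_topology Y) U" "openin (cw_topology Y) U"
    by (auto simp: closedin_def top openin_cw_topology U_sub)
  then have "U = {} \<or> U = points Y"
    using conn by (auto simp: connected_space_clopen_in top)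
  moreover have "y \<in> U"
  proof -
    have "edge_path Y y [] y" by simp
    with y have "y \<in> C" unfolding C_def by blast
    with U_vert y show ?thesis by simp
  qed
  ultimately have "v \<in> U"
    using v by (auto simp: points_def skeleton1_def)
  then show ?thesis
    using U_vert[OF v] by (simp add: C_def)
qed

section \<open>Coarse distances\<close>

text \<open>The only directed edges through \<open>q\<close> are \<open>e\<close> and its reverse,
  so the minimum runs over the two endpoints of \<open>e\<close>.\<close>

lemma coarse_dist1_open_edge:
  assumes Y: "combinatorial_complex Y" and e: "e \<in> edges Y" and q: "q \<in> open_edge e"
  shows "coarse_dist1 Y y q = real (min (vdist Y y (e 0)) (vdist Y y (e 1))) + 1/2"
proof -
  have "q \<notin> verts Y"
    using complex_edgeD(4)[OF Y e] q by auto
  moreover have "{real (vdist Y y v) | v. \<exists>e\<in>edges Y. q \<in> open_edge e \<and> v \<in> {e 0, e 1}} =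
      {real (vdist Y y (e 0)), real (vdist Y y (e 1))}"
    using complex_edge_eq[OF Y e _ q] e q by force
  ultimately show ?thesis
    by (simp add: coarse_dist1_def)
qed

text \<open>Disjointness of open 2-cells leaves only \<open>\<Phi>\<close> in the defining set, and
  all boundary paths of \<open>\<Phi>\<close> cover the same open edges, so an arbitrary
  \<open>es\<close> computes the maximum.\<close>

lemma coarse_dist_open_face:
  assumes Y: "combinatorial_complex Y" and \<Phi>: "\<Phi> \<in> faces Y" and es: "face_boundary Y \<Phi> es"
    and p: "p \<in> open_face \<Phi>"
  shows "coarse_dist Y y p = Max (coarse_dist1 Y y ` (\<Union>e\<in>set es. open_edge e)) - 1/4"
proof -
  have notin: "p \<notin> skeleton1 Y"
    using complex_faceD(1)[OF Y \<Phi>] p by blast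
  have eq: "{coarse_dist1 Y y q | q. \<exists>\<Phi>\<in>faces Y. \<exists>es. \<exists>e\<in>set es.
      p \<in> open_face \<Phi> \<and> face_boundary Y \<Phi> es \<and> q \<in> open_edge e} =
      coarse_dist1 Y y ` (\<Union>e\<in>set es. open_edge e)" (is "?L = ?R")
  proof (intro equalityI subsetI)
    fix x assume "x \<in> ?L"
    then obtain q \<Phi>' es' e where q: "x = coarse_dist1 Y y q" "\<Phi>' \<in> faces Y" "e \<in> set es'"
      "p \<in> open_face \<Phi>'" "face_boundary Y \<Phi>' es'" "q \<in> open_edge e"
      unfolding mem_Collect_eq by (elim exE bexE conjE) (rule that)
    have "\<Phi>' = \<Phi>"
      by (rule complex_face_eq[OF Y \<Phi> q(2) p q(4)])
    with q(5) have "(\<Union>e\<in>set es'. open_edge e) = (\<Union>e\<in>set es. open_edge e)"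
      using open_edges_face_boundary[OF Y] es by metis
    moreover have "q \<in> (\<Union>e\<in>set es'. open_edge e)"
      using q(3,6) by blast
    ultimately show "x \<in> ?R"
      unfolding q(1) by (intro imageI) (simp only:)
  next
    fix x assume "x \<in> ?R"
    then obtain e q where "e \<in> set es" "q \<in> open_edge e" "x = coarse_dist1 Y y q" by auto
    with \<Phi> es p have "x = coarse_dist1 Y y q \<and> (\<exists>\<Phi>\<in>faces Y. \<exists>es. \<exists>e\<in>set es.
        p \<in> open_face \<Phi> \<and> face_boundary Y \<Phi> es \<and> q \<in> open_edge e)"
      by blast
    then show "x \<in> ?L" by blast
  qed
  show ?thesis
    unfolding coarse_dist_def eq by (simp only: notin if_False)
qed

text \<open>The value is constant on each open edge, so infinitely many points contribute at most
  one value per edge. This gives \<open>Max\<close> its meaning.\<close>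

lemma finite_coarse_dist1:
  assumes Y: "combinatorial_complex Y" and es: "set es \<subseteq> edges Y"
  shows "finite (coarse_dist1 Y y ` (\<Union>e\<in>set es. open_edge e))"
proof (rule finite_subset)
  show "coarse_dist1 Y y ` (\<Union>e\<in>set es. open_edge e) \<subseteq>
      (\<lambda>e. real (min (vdist Y y (e 0)) (vdist Y y (e 1))) + 1/2) ` set es"
    using coarse_dist1_open_edge[OF Y] es by blast
qed simp

lemma open_edges_nonempty:
  assumes "es \<noteq> []"
  shows "(\<Union>e\<in>set es. open_edge e) \<noteq> {}"
  using assms hd_in_set[of es] open_edgeI[of "1/2" "hd es"] by fastforce

text \<open>The function \<open>f\<close> is monotone only on \<open>quarter_nats\<close>, so
  distances must be known to lie there before \<open>f\<close> is applied to an inequality between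
  them.\<close>

lemma coarse_dist_quarter_nats:
  assumes Y: "combinatorial_complex Y" and p: "p \<in> points Y"
  shows "coarse_dist Y y p \<in> quarter_nats"
proof -
  have quarter: "x \<in> quarter_nats" if "x = real n / 4" for x n
    using that by (simp add: quarter_nats_def)
  consider "p \<in> verts Y" | e where "e \<in> edges Y" "p \<in> open_edge e"
    | \<Phi> where "\<Phi> \<in> faces Y" "p \<in> open_face \<Phi>"
    using p by (auto simp: points_def skeleton1_def)
  then show ?thesis
  proof cases
    case 1
    then show ?thesis
      by (intro quarter[of _ "4 * vdist Y y p"])
        (simp add: coarse_dist_def skeleton1_def coarse_dist1_def)
  next
    case (2 e)
    then have "coarse_dist Y y p = coarse_dist1 Y y p"
      by (auto simp: coarse_dist_def skeleton1_def)
    then show ?thesis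
      by (intro quarter[of _ "4 * min (vdist Y y (e 0)) (vdist Y y (e 1)) + 2"])
        (simp add: coarse_dist1_open_edge[OF Y 2] add_divide_distrib)
  next
    case (3 \<Phi>)
    obtain es where es: "face_boundary Y \<Phi> es"
      using complex_faceD(2)[OF Y 3(1)] by blast
    then have sub: "set es \<subseteq> edges Y" and "es \<noteq> []"
      by (auto simp: face_boundary_def)
    let ?S = "coarse_dist1 Y y ` (\<Union>e\<in>set es. open_edge e)"
    \<comment> \<open>The maximum is attained on a single edge, so it is m + 1/2 for a natural m,
      and subtracting 1/4 leaves (4m + 1)/4.\<close>
    have "Max ?S \<in> ?S"
      using finite_coarse_dist1[OF Y sub] open_edges_nonempty[OF \<open>es \<noteq> []\<close>] by (intro Max_in) auto
    then obtain e q where "e \<in> set es" "q \<in> open_edge e" "Max ?S = coarse_dist1 Y y q"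
      by auto
    then have "Max ?S = real (min (vdist Y y (e 0)) (vdist Y y (e 1))) + 1/2"
      using coarse_dist1_open_edge[OF Y] sub by auto
    then show ?thesis
      by (intro quarter[of _ "4 * min (vdist Y y (e 0)) (vdist Y y (e 1)) + 1"])
        (simp add: coarse_dist_open_face[OF Y 3(1) es 3(2)] add_divide_distrib)
  qed
qed

section \<open>Combinatorial maps\<close>

text \<open>This keeps what the estimates use of the canonical map and forgets labels and the group.
  Vertices have their own clause because an isolated vertex is the endpoint of no edge.\<close>

definition combinatorial_map ::
    "('p, 'y) complex2_scheme \<Rightarrow> ('q, 'x) complex2_scheme \<Rightarrow> ('p \<Rightarrow> 'q) \<Rightarrow> bool" where
  "combinatorial_map Y X \<pi> \<longleftrightarrow> \<pi> ` verts Y \<subseteq> verts X \<and>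
     (\<forall>e\<in>edges Y. \<exists>e'\<in>edges X. \<forall>t\<in>{0..1}. \<pi> (e t) = e' t) \<and>
     (\<forall>\<Phi>\<in>faces Y. \<exists>\<Phi>'\<in>faces X. \<forall>z\<in>cball 0 1. \<pi> (\<Phi> z) = \<Phi>' z)"

lemma combinatorial_map_edge:
  assumes "combinatorial_map Y X \<pi>" "e \<in> edges Y"
  obtains e' where "e' \<in> edges X" "\<And>t. t \<in> {0..1} \<Longrightarrow> \<pi> (e t) = e' t"
    "e' 0 = \<pi> (e 0)" "e' 1 = \<pi> (e 1)" "open_edge e' = \<pi> ` open_edge e"
proof -
  obtain e' where e': "e' \<in> edges X" "\<And>t. t \<in> {0..1} \<Longrightarrow> \<pi> (e t) = e' t"
    using assms unfolding combinatorial_map_def by blast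
  moreover have "open_edge e' = \<pi> ` open_edge e"
    unfolding open_edge_def image_image by (rule image_cong) (simp_all add: e')
  ultimately show thesis
    using that e'(2)[of 0] e'(2)[of 1] by simp
qed

lemma combinatorial_map_edge_path:
  assumes "combinatorial_map Y X \<pi>" "edge_path Y u es v"
  shows "\<exists>es'. length es' = length es \<and> edge_path X (\<pi> u) es' (\<pi> v)"
  using assms(2)
proof (induction es arbitrary: u)
  case (Cons e es)
  then obtain es' where es': "length es' = length es" "edge_path X (\<pi> (e 1)) es' (\<pi> v)"
    by auto
  obtain e' where "e' \<in> edges X" "e' 0 = \<pi> (e 0)" "e' 1 = \<pi> (e 1)"
    using combinatorial_map_edge[OF assms(1)] Cons.prems by (metis edge_path.simps(2))
  then have "edge_path X (\<pi> u) (e' # es') (\<pi> v)"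
    using es' Cons.prems by simp
  with es'(1) show ?case by (intro exI[of _ "e' # es'"]) simp
qed auto

text \<open>A shortest path in \<open>Y\<close> is pushed forward to a path of the same length; the
  given path ensures that a shortest one exists.\<close>

lemma combinatorial_map_vdist_le:
  assumes "combinatorial_map Y X \<pi>" "edge_path Y u es v"
  shows "vdist X (\<pi> u) (\<pi> v) \<le> vdist Y u v"
proof -
  obtain fs where "edge_path Y u fs v" "length fs = vdist Y u v"
    using vdist_edge_path[OF assms(2)] .
  with combinatorial_map_edge_path[OF assms(1)] show ?thesis
    by (metis vdist_le)
qed

text \<open>Replacing each edge of the boundary path by its image gives a boundary path of the image
  cell. The second conclusion lets the maxima in \<open>Y\<close> and \<open>X\<close> be compared
  point by point.\<close>

lemma combinatorial_map_face_boundary: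
  assumes \<pi>: "combinatorial_map Y X \<pi>" and es: "face_boundary Y \<Phi> es"
    and \<Phi>': "\<And>z. z \<in> cball 0 1 \<Longrightarrow> \<pi> (\<Phi> z) = \<Phi>' z"
  obtains es' where "face_boundary X \<Phi>' es'"
    "(\<Union>e\<in>set es'. open_edge e) = \<pi> ` (\<Union>e\<in>set es. open_edge e)"
proof -
  have "\<exists>e'. e' \<in> edges X \<and> (\<forall>t\<in>{0..1}. \<pi> (e t) = e' t) \<and> open_edge e' = \<pi> ` open_edge e"
    if "e \<in> edges Y" for e
    using combinatorial_map_edge[OF \<pi> that] by metis
  then obtain h where h: "\<And>e. e \<in> edges Y \<Longrightarrow> h e \<in> edges X"
      "\<And>e t. e \<in> edges Y \<Longrightarrow> t \<in> {0..1} \<Longrightarrow> \<pi> (e t) = h e t"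
      "\<And>e. e \<in> edges Y \<Longrightarrow> open_edge (h e) = \<pi> ` open_edge e"
    by metis
  have sub: "set es \<subseteq> edges Y" "es \<noteq> []" and tr: "traces \<Phi> es"
    using es by (auto simp: face_boundary_def)
  show thesis
  proof
    have "\<Phi>' (cis (2 * pi * (real k + t) / real (length es))) = (map h es ! k) t"
      if "k < length es" "t \<in> {0..1}" for k t
    proof -
      have "\<Phi>' (cis (2 * pi * (real k + t) / real (length es))) = \<pi> ((es ! k) t)"
        using tr that \<Phi>'[of "cis (2 * pi * (real k + t) / real (length es))"]
        by (simp add: traces_def)
      also have "\<dots> = h (es ! k) t"
        using h(2)[of "es ! k" t] that sub nth_mem[of k es] by blast
      finally show ?thesis using that by simp
    qed
    then show "face_boundary X \<Phi>' (map h es)"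
      using sub h(1) by (auto simp: face_boundary_def traces_def)
    have "(\<Union>e\<in>set (map h es). open_edge e) = (\<Union>e\<in>set es. \<pi> ` open_edge e)"
      using h(3) sub(1) by (simp add: subset_iff)
    then show "(\<Union>e\<in>set (map h es). open_edge e) = \<pi> ` (\<Union>e\<in>set es. open_edge e)"
      by (simp only: image_UN)
  qed
qed

text \<open>The three conclusions share one case distinction on the cell containing
  \<open>p\<close>. The assumption on \<open>j\<close> concerns vertices only and is carried to
  edges by minima and to 2-cells by maxima.\<close>

lemma combinatorial_map_coarse_dist:
  assumes Y: "combinatorial_complex Y" "connected_space (cw_topology Y)"
    and X: "combinatorial_complex X" and \<pi>: "combinatorial_map Y X \<pi>"
    and y: "y \<in> verts Y" and p: "p \<in> points Y"
  shows combinatorial_map_points: "\<pi> p \<in> points X"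
    and combinatorial_map_coarse_dist_le: "coarse_dist X (\<pi> y) (\<pi> p) \<le> coarse_dist Y y p"
    and combinatorial_map_coarse_dist_ge:
      "mono j \<Longrightarrow> (\<And>v. v \<in> verts Y \<Longrightarrow> vdist Y y v \<le> j (vdist X (\<pi> y) (\<pi> v))) \<Longrightarrow>
        coarse_dist Y y p \<le> j_tilde j (coarse_dist X (\<pi> y) (\<pi> p))"
proof -
  have le_vert: "vdist X (\<pi> y) (\<pi> v) \<le> vdist Y y v" if v: "v \<in> verts Y" for v
    using connected_complex_edge_path[OF Y y v] combinatorial_map_vdist_le[OF \<pi>] by blast
  have edge: "coarse_dist1 X (\<pi> y) (\<pi> q) =
      real (min (vdist X (\<pi> y) (\<pi> (e 0))) (vdist X (\<pi> y) (\<pi> (e 1)))) + 1/2 \<and> \<pi> q \<in> skeleton1 X"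
    if e: "e \<in> edges Y" and q: "q \<in> open_edge e" for e q
  proof -
    obtain e' where e': "e' \<in> edges X" "e' 0 = \<pi> (e 0)" "e' 1 = \<pi> (e 1)"
        "open_edge e' = \<pi> ` open_edge e"
      by (rule combinatorial_map_edge[OF \<pi> e])
    then have "\<pi> q \<in> open_edge e'" using q by simp
    with e' show ?thesis
      using coarse_dist1_open_edge[OF X e'(1)] by (auto simp: skeleton1_def)
  qed
  have le_edge: "coarse_dist1 X (\<pi> y) (\<pi> q) \<le> coarse_dist1 Y y q"
    if e: "e \<in> edges Y" and q: "q \<in> open_edge e" for e q
    using le_vert[of "e 0"] le_vert[of "e 1"] complex_edgeD[OF Y(1) e] edge[OF e q]
    by (simp add: coarse_dist1_open_edge[OF Y(1) e q]) linarith
  \<comment> \<open>The slack 1/4 lets one bound serve twice: \<open>c\<close> is the value of the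
    edge itself for a point on an edge, and a maximum minus 1/4 for a point in a 2-cell.\<close>
  have ge_edge: "coarse_dist1 Y y q \<le> real (j (nat \<lceil>c\<rceil>)) + 1/2"
    if e: "e \<in> edges Y" and q: "q \<in> open_edge e" and j: "mono j"
      and vj: "\<And>v. v \<in> verts Y \<Longrightarrow> vdist Y y v \<le> j (vdist X (\<pi> y) (\<pi> v))"
      and c: "coarse_dist1 X (\<pi> y) (\<pi> q) - 1/4 \<le> c" for e q j c
  proof -
    let ?m = "min (vdist X (\<pi> y) (\<pi> (e 0))) (vdist X (\<pi> y) (\<pi> (e 1)))"
    \<comment> \<open>Take the endpoint whose image realises \<open>?m\<close>: its distance in
      \<open>Y\<close> is at most \<open>j ?m\<close> and bounds the minimum from above.\<close>
    have "min (vdist Y y (e 0)) (vdist Y y (e 1)) \<le> j ?m"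
      using vj[of "e 0"] vj[of "e 1"] complex_edgeD[OF Y(1) e] by (auto simp: min_def)
    also have "j ?m \<le> j (nat \<lceil>c\<rceil>)"
    proof (rule monoD[OF j])
      \<comment> \<open>The value of the edge in \<open>X\<close> is \<open>?m\<close> + 1/2, so
        \<open>c\<close> is at least \<open>?m\<close> + 1/4.\<close>
      have "real ?m \<le> c" using edge[OF e q] c by simp
      then show "?m \<le> nat \<lceil>c\<rceil>" by linarith
    qed
    finally show ?thesis
      by (simp add: coarse_dist1_open_edge[OF Y(1) e q])
  qed
  consider (in_verts) "p \<in> verts Y" | (in_edge) e where "e \<in> edges Y" "p \<in> open_edge e"
    | (in_face) \<Phi> where "\<Phi> \<in> faces Y" "p \<in> open_face \<Phi>"
    using p by (auto simp: points_def skeleton1_def)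
  \<comment> \<open>Only the third claim involves \<open>j\<close>; quantifying it here allows one
    case distinction for all three.\<close>
  then have "\<pi> p \<in> points X \<and> coarse_dist X (\<pi> y) (\<pi> p) \<le> coarse_dist Y y p \<and>
    (\<forall>j. mono j \<longrightarrow> (\<forall>v\<in>verts Y. vdist Y y v \<le> j (vdist X (\<pi> y) (\<pi> v))) \<longrightarrow>
      coarse_dist Y y p \<le> j_tilde j (coarse_dist X (\<pi> y) (\<pi> p)))"
  proof cases
    case in_verts
    then have "\<pi> p \<in> verts X"
      using \<pi> by (auto simp: combinatorial_map_def)
    then have "\<pi> p \<in> points X" "coarse_dist X (\<pi> y) (\<pi> p) = real (vdist X (\<pi> y) (\<pi> p))"
      "coarse_dist Y y p = real (vdist Y y p)"
      using in_verts by (simp_all add: points_def coarse_dist_def skeleton1_def coarse_dist1_def)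
    then show ?thesis
      using le_vert[OF in_verts] in_verts by (force simp: j_tilde_def)
  next
    case (in_edge e)
    have eq: "coarse_dist X (\<pi> y) (\<pi> p) = coarse_dist1 X (\<pi> y) (\<pi> p)"
      "coarse_dist Y y p = coarse_dist1 Y y p" "\<pi> p \<in> points X"
      using edge[OF in_edge] in_edge by (auto simp: coarse_dist_def skeleton1_def points_def)
    then show ?thesis
      using le_edge[OF in_edge] ge_edge[OF in_edge, of _ "coarse_dist1 X (\<pi> y) (\<pi> p)"]
      by (force simp: j_tilde_def)
  next
    case (in_face \<Phi>)
    obtain \<Phi>' where \<Phi>': "\<Phi>' \<in> faces X" "\<And>z. z \<in> cball 0 1 \<Longrightarrow> \<pi> (\<Phi> z) = \<Phi>' z"
      using \<pi> in_face(1) unfolding combinatorial_map_def by blast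
    have p': "\<pi> p \<in> open_face \<Phi>'"
      using in_face(2) \<Phi>'(2) by (force simp: open_face_def)
    obtain es where es: "face_boundary Y \<Phi> es"
      using complex_faceD(2)[OF Y(1) in_face(1)] by blast
    obtain es' where es': "face_boundary X \<Phi>' es'"
        "(\<Union>e\<in>set es'. open_edge e) = \<pi> ` (\<Union>e\<in>set es. open_edge e)"
      by (rule combinatorial_map_face_boundary[OF \<pi> es \<Phi>'(2)])
    have sub: "set es \<subseteq> edges Y" "es \<noteq> []" "set es' \<subseteq> edges X" "es' \<noteq> []"
      using es es'(1) by (auto simp: face_boundary_def)
    let ?S = "\<Union>e\<in>set es. open_edge e"
    have S: "?S \<noteq> {}"
      by (rule open_edges_nonempty[OF sub(2)])
    have finY: "finite (coarse_dist1 Y y ` ?S)"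
      by (rule finite_coarse_dist1[OF Y(1) sub(1)])
    have finX: "finite (coarse_dist1 X (\<pi> y) ` \<pi> ` ?S)"
      using finite_coarse_dist1[OF X sub(3)] es'(2) by simp
    have dX: "coarse_dist X (\<pi> y) (\<pi> p) = Max (coarse_dist1 X (\<pi> y) ` \<pi> ` ?S) - 1/4"
      using coarse_dist_open_face[OF X \<Phi>'(1) es'(1) p'] es'(2) by simp
    have dY: "coarse_dist Y y p = Max (coarse_dist1 Y y ` ?S) - 1/4"
      by (rule coarse_dist_open_face[OF Y(1) in_face(1) es in_face(2)])
    have "\<pi> p \<in> points X"
      using p' \<Phi>'(1) by (auto simp: points_def)
    moreover have "Max (coarse_dist1 X (\<pi> y) ` \<pi> ` ?S) \<le> Max (coarse_dist1 Y y ` ?S)"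
    proof (rule Max.boundedI[OF finX])
      fix x assume "x \<in> coarse_dist1 X (\<pi> y) ` \<pi> ` ?S"
      then obtain e q where q: "e \<in> set es" "q \<in> open_edge e" "x = coarse_dist1 X (\<pi> y) (\<pi> q)"
        by auto
      then have "x \<le> coarse_dist1 Y y q"
        using le_edge sub(1) by auto
      also have "\<dots> \<le> Max (coarse_dist1 Y y ` ?S)"
        using q by (intro Max_ge finY) blast
      finally show "x \<le> Max (coarse_dist1 Y y ` ?S)" .
    qed (use S in simp)
    moreover have "coarse_dist Y y p \<le> j_tilde j (coarse_dist X (\<pi> y) (\<pi> p))"
      if j: "mono j" "\<forall>v\<in>verts Y. vdist Y y v \<le> j (vdist X (\<pi> y) (\<pi> v))" for j
    proof -
      let ?c = "coarse_dist X (\<pi> y) (\<pi> p)"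
      \<comment> \<open>Every boundary edge has value at most \<open>?c\<close> + 1/4 in
        \<open>X\<close>, so \<open>ge_edge\<close> applies to all of them with the same
        \<open>?c\<close>.\<close>
      have "Max (coarse_dist1 Y y ` ?S) \<le> real (j (nat \<lceil>?c\<rceil>)) + 1/2"
      proof (rule Max.boundedI[OF finY])
        fix x assume "x \<in> coarse_dist1 Y y ` ?S"
        then obtain e q where q: "e \<in> set es" "q \<in> open_edge e" "x = coarse_dist1 Y y q"
          by auto
        have "coarse_dist1 X (\<pi> y) (\<pi> q) \<le> Max (coarse_dist1 X (\<pi> y) ` \<pi> ` ?S)"
          using q by (intro Max_ge finX) blast
        then show "x \<le> real (j (nat \<lceil>?c\<rceil>)) + 1/2"
          using ge_edge[of e q j ?c] q sub(1) j by (auto simp: dX)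
      qed (use S in simp)
      then show ?thesis by (simp add: dY j_tilde_def)
    qed
    ultimately show ?thesis by (simp add: dX dY)
  qed
  then show "\<pi> p \<in> points X" "coarse_dist X (\<pi> y) (\<pi> p) \<le> coarse_dist Y y p"
    "mono j \<Longrightarrow> (\<And>v. v \<in> verts Y \<Longrightarrow> vdist Y y v \<le> j (vdist X (\<pi> y) (\<pi> v))) \<Longrightarrow>
        coarse_dist Y y p \<le> j_tilde j (coarse_dist X (\<pi> y) (\<pi> p))"
    by blast+
qed

section \<open>The Cayley complex\<close>

lemma word_value_closed:
  assumes "group G" "A \<subseteq> carrier G" "w \<in> lists A"
  shows "word_value G w \<in> carrier G"
  using assms(3)
proof (induction w)
  case Nil
  then show ?case using assms(1) by (simp add: word_value_def group.is_monoid monoid.one_closed)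
next
  case (Cons a w)
  then show ?case
    using assms(1,2) by (auto simp: word_value_def group.is_monoid monoid.m_closed)
qed

text \<open>\<open>word_value\<close> folds from the front, whereas the prefixes read along a 2-cell
  grow at the end; associativity reconciles the two.\<close>

lemma word_value_snoc:
  assumes "group G" "A \<subseteq> carrier G" "w \<in> lists A" "a \<in> A"
  shows "word_value G (w @ [a]) = word_value G w \<otimes>\<^bsub>G\<^esub> a"
proof -
  interpret group G by fact
  show ?thesis
    using assms(3)
  proof (induction w)
    case Nil
    then show ?case using assms by (auto simp: word_value_def)
  next
    case (Cons b w)
    then have "word_value G w \<in> carrier G"
      by (intro word_value_closed[OF assms(1,2)]) auto
    with Cons assms show ?case
      by (auto simp: word_value_def m_assoc subset_iff)
  qed
qed

text \<open>A relator is deleted to the empty word in one step, and the presentation turns this into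
  equality in the group.\<close>

lemma word_value_relator:
  assumes "finite_symmetrized_presentation G A R" "r \<in> R"
  shows "word_value G r = \<one>\<^bsub>G\<^esub>"
proof -
  have "deletes A (cancelling_pairs G A \<union> R) r []"
    unfolding deletes_def using assms(2) by (intro bexI[of _ "[]"] bexI[of _ r]) auto
  then have "equivclp (deletes A (cancelling_pairs G A \<union> R)) r []"
    by (rule r_into_equivclp)
  moreover have "r \<in> lists A"
    using assms by (auto simp: finite_symmetrized_presentation_def)
  ultimately show ?thesis
    using assms(1) by (auto simp: finite_symmetrized_presentation_def)
qed

lemma cayley_edge_0: "cayley_edge G g a 0 = Vertex g"
  and cayley_edge_1: "cayley_edge G g a 1 = Vertex (g \<otimes>\<^bsub>G\<^esub> a)"
  by (simp_all add: cayley_edge_def)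

text \<open>The two coordinates of an edge point form an unordered pair, so reversing the edge
  merely swaps them.\<close>

lemma (in group) rev_edge_cayley_edge:
  assumes "g \<in> carrier G" "a \<in> carrier G"
  shows "rev_edge (cayley_edge G g a) = cayley_edge G (g \<otimes> a) (inv a)"
  using assms by (auto simp: rev_edge_def cayley_edge_def fun_eq_iff m_assoc insert_commute)

text \<open>Edge \<open>k\<close> starts at the vertex reached from \<open>g\<close> by reading the
  first \<open>k\<close> letters of \<open>r\<close>; the path closes up because a relator has value
  one.\<close>

lemma cayley_face_boundary:
  fixes G (structure)
  assumes G: "group G" and P: "finite_symmetrized_presentation G A R"
    and g: "g \<in> carrier G" and r: "r \<in> R"
  shows "face_boundary (cayley_complex G A R) (cayley_face G g r)
    (map (\<lambda>k. cayley_edge G (g \<otimes>\<^bsub>G\<^esub> word_value G (take k r)) (r ! k)) [0..<length r])"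
    (is "face_boundary ?X ?\<Phi> ?es")
proof -
  interpret group G by fact
  let ?n = "length r"
  have A: "A \<subseteq> carrier G" and rA: "r \<in> lists A" and ne: "r \<noteq> []"
    using P r by (auto simp: finite_symmetrized_presentation_def)
  have take_in: "take k r \<in> lists A" for k
    using rA by (auto dest: in_set_takeD)
  note closed = word_value_closed[OF G A take_in]
  have nth_in: "r ! k \<in> A" if "k < ?n" for k
    using rA that by auto
  have vertex: "g \<otimes> word_value G (take k r) \<otimes> r ! k = g \<otimes> word_value G (take (Suc k) r)"
    if "k < ?n" for k
    using word_value_snoc[OF G A take_in nth_in[OF that], of k] nth_in[OF that] A g closed[of k] that
    by (simp add: take_Suc_conv_app_nth m_assoc subset_iff)
  \<comment> \<open>On a half-open arc the floor and the fractional part in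
    \<open>cayley_face\<close> recover \<open>k\<close> and \<open>t\<close>. At
    \<open>t = 1\<close> the floor moves on or the angle wraps to 0, so that endpoint is left to
    \<open>last\<close>.\<close>
  have arc: "?\<Phi> (cis (2 * pi * (real k + t) / real ?n)) =
      cayley_edge G (g \<otimes> word_value G (take k r)) (r ! k) t"
    if k: "k < ?n" and t: "0 \<le> t" "t < 1" for k t
  proof -
    have "real k + t < real ?n" using k t by linarith
    then have "2 * pi * (real k + t) / real ?n < 2 * pi"
      using ne by (simp add: pos_divide_less_eq)
    then have "Arg2pi (cis (2 * pi * (real k + t) / real ?n)) = 2 * pi * (real k + t) / real ?n"
      using t by (intro Arg2pi_unique[of 1]) (auto simp: cis_conv_exp)
    then have "real ?n * Arg2pi (cis (2 * pi * (real k + t) / real ?n)) / (2 * pi) = real k + t"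
      using ne by (simp add: field_simps)
    moreover have "\<lfloor>real k + t\<rfloor> = int k" using t by linarith
    moreover from this have "frac (real k + t) = t" by (simp add: frac_def)
    ultimately show ?thesis by (simp add: cayley_face_def)
  qed
  have last: "?\<Phi> (cis (2 * pi * (real k + 1) / real ?n)) =
      cayley_edge G (g \<otimes> word_value G (take k r)) (r ! k) 1" if k: "k < ?n" for k
  proof (cases "Suc k < ?n")
    case True
    then show ?thesis
      using arc[OF True, of 0] vertex[OF k] by (simp add: cayley_edge_0 cayley_edge_1 add.commute)
  next
    case False
    with k have n: "?n = Suc k" by simp
    have "cis (2 * pi * (real k + 1) / real ?n) = cis (2 * pi * (real 0 + 0) / real ?n)"
      by (simp add: n add.commute)
    then have "?\<Phi> (cis (2 * pi * (real k + 1) / real ?n)) = Vertex g"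
      using arc[of 0 0] ne g by (simp add: cayley_edge_0 word_value_def)
    moreover have "g \<otimes> word_value G (take k r) \<otimes> r ! k = g"
      using vertex[OF k] g word_value_relator[OF P r] n by simp
    ultimately show ?thesis by (simp add: cayley_edge_1)
  qed
  have "?\<Phi> (cis (2 * pi * (real k + t) / real ?n)) =
      cayley_edge G (g \<otimes> word_value G (take k r)) (r ! k) t"
    if "k < ?n" "t \<in> {0..1}" for k t
    using arc[OF that(1), of t] last[OF that(1)] that(2) by (cases "t = 1") auto
  then have "traces ?\<Phi> ?es"
    by (simp add: traces_def)
  moreover have "set ?es \<subseteq> edges ?X"
    using g closed nth_in by (fastforce simp: cayley_complex_def)
  ultimately show ?thesis
    using ne by (simp add: face_boundary_def)
qed

lemma open_edge_cayley_edge: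
  "open_edge (cayley_edge G g a) =
    {Edge_Point {(g, a, t), (g \<otimes>\<^bsub>G\<^esub> a, inv\<^bsub>G\<^esub> a, 1 - t)} | t. 0 < t \<and> t < 1}"
  by (force simp: open_edge_def cayley_edge_def)

lemma open_face_cayley_face:
  "open_face (cayley_face G g r) = {Face_Point g r z | z. norm z < 1}"
  by (force simp: open_face_def cayley_face_def)

text \<open>Constructors separate the three kinds of points. The care goes into edge points, whose
  unordered pairs of coordinates can match in order or swapped.\<close>

lemma combinatorial_complex_cayley_complex:
  fixes G (structure)
  assumes G: "group G" and P: "finite_symmetrized_presentation G A R"
  shows "combinatorial_complex (cayley_complex G A R)" (is "combinatorial_complex ?X")
proof -
  interpret group G by fact
  have A: "A \<subseteq> carrier G" and invA: "\<And>a. a \<in> A \<Longrightarrow> inv a \<in> A" and one: "\<one> \<notin> A"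
    using P by (auto simp: finite_symmetrized_presentation_def)
  have edgesE: "\<exists>g a. e = cayley_edge G g a \<and> g \<in> carrier G \<and> a \<in> A \<and> a \<in> carrier G"
    if "e \<in> edges ?X" for e
    using that A by (auto simp: cayley_complex_def)
  have facesE: "\<exists>g r. \<Phi> = cayley_face G g r \<and> g \<in> carrier G \<and> r \<in> R" if "\<Phi> \<in> faces ?X" for \<Phi>
    using that by (auto simp: cayley_complex_def)
  show ?thesis
    unfolding combinatorial_complex_def
  proof (intro conjI ballI impI)
    fix e assume "e \<in> edges ?X"
    then obtain g a where e: "e = cayley_edge G g a" "g \<in> carrier G" "a \<in> A" "a \<in> carrier G"
      using edgesE by blast
    show "e 0 \<in> verts ?X" "e 1 \<in> verts ?X"
      using e by (auto simp: cayley_complex_def cayley_edge_0 cayley_edge_1)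
    show "rev_edge e \<in> edges ?X"
      using e invA by (auto simp: rev_edge_cayley_edge cayley_complex_def)
    show "open_edge e \<inter> verts ?X = {}"
      by (auto simp: e open_edge_cayley_edge cayley_complex_def)
    show "inj_on e {0<..<1}"
    proof (rule inj_onI)
      fix s t :: real assume "s \<in> {0<..<1}" "t \<in> {0<..<1}" "e s = e t"
      then have "{(g, a, s), (g \<otimes> a, inv a, 1 - s)} = {(g, a, t), (g \<otimes> a, inv a, 1 - t)}"
        by (simp add: e cayley_edge_def)
      \<comment> \<open>A swapped match would force g = ga, hence a trivial generator, and the edge
        would be folded at its midpoint.\<close>
      moreover have "g \<noteq> g \<otimes> a"
        using e one by auto
      ultimately show "s = t" by (auto simp: doubleton_eq_iff)
    qed
  next
    fix e e' assume "e \<in> edges ?X" "e' \<in> edges ?X" and meet: "open_edge e \<inter> open_edge e' \<noteq> {}"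
    then obtain g a g' a' where e: "e = cayley_edge G g a" "g \<in> carrier G" "a \<in> carrier G"
      and e': "e' = cayley_edge G g' a'"
      using edgesE by metis
    from meet obtain p where "p \<in> open_edge e" "p \<in> open_edge e'" by blast
    then obtain s t :: real where
      "{(g, a, s), (g \<otimes> a, inv a, 1 - s)} = {(g', a', t), (g' \<otimes> a', inv a', 1 - t)}"
      unfolding e(1) e' open_edge_cayley_edge by blast
    then have "g' = g \<and> a' = a \<or> g' = g \<otimes> a \<and> a' = inv a"
      by (auto simp: doubleton_eq_iff)
    then show "e' = e \<or> e' = rev_edge e"
      using e e' rev_edge_cayley_edge by auto
  next
    fix \<Phi> assume "\<Phi> \<in> faces ?X"
    then obtain g r where \<Phi>: "\<Phi> = cayley_face G g r" "g \<in> carrier G" "r \<in> R"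
      using facesE by blast
    show "inj_on \<Phi> (ball 0 1)"
      by (auto simp: \<Phi>(1) inj_on_def cayley_face_def)
    have "p \<notin> skeleton1 ?X" if "p \<in> open_face \<Phi>" for p
    proof -
      from that obtain z where "p = Face_Point g r z"
        by (auto simp: \<Phi>(1) open_face_cayley_face)
      then show ?thesis
        by (auto simp: skeleton1_def cayley_complex_def open_edge_cayley_edge)
    qed
    then show "open_face \<Phi> \<inter> skeleton1 ?X = {}" by blast
    show "\<exists>es. face_boundary ?X \<Phi> es"
      using cayley_face_boundary[OF G P \<Phi>(2,3)] \<Phi>(1) by blast
  next
    fix \<Phi> \<Phi>' assume "\<Phi> \<in> faces ?X" "\<Phi>' \<in> faces ?X" and meet: "open_face \<Phi> \<inter> open_face \<Phi>' \<noteq> {}"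
    then obtain g r g' r' where "\<Phi> = cayley_face G g r" "\<Phi>' = cayley_face G g' r'"
      using facesE by metis
    with meet show "\<Phi>' = \<Phi>"
      by (auto simp: open_face_cayley_face)
  qed
qed

section \<open>Van Kampen diagrams\<close>

text \<open>Contractibility refers to the topology of the plane; the planarity condition identifies
  it with the weak topology.\<close>

lemma van_kampen_diagram_connected:
  assumes "van_kampen_diagram G A R w \<Delta>"
  shows "connected_space (cw_topology \<Delta>)"
proof -
  have "connected (points \<Delta>)"
    using assms by (auto simp: van_kampen_diagram_def intro: contractible_imp_connected)
  then show ?thesis
    using assms by (simp add: van_kampen_diagram_def connectedin_def
        flip: connectedin_iff_connected)
qed

lemma edge_path_end:
  assumes "edge_path Y u es v" "es \<noteq> []"
  shows "\<exists>e\<in>edges Y. e 1 = v"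
  using assms by (induction es arbitrary: u) fastforce+

text \<open>Among vertices, \<open>canonical_map\<close> fixes the image of the base only. Any other
  vertex ends a nonempty edge path from the base, so it is the end of an edge and goes to the end of
  a Cayley edge.\<close>

lemma canonical_map_combinatorial_map:
  assumes G: "group G" and P: "finite_symmetrized_presentation G A R"
    and \<Delta>: "van_kampen_diagram G A R w \<Delta>" and \<pi>: "canonical_map G A R \<Delta> \<pi>"
  shows "combinatorial_map \<Delta> (cayley_complex G A R) \<pi>"
proof -
  let ?X = "cayley_complex G A R"
  have cc: "combinatorial_complex \<Delta>" and base: "base \<Delta> \<in> verts \<Delta>"
    and label: "\<And>e. e \<in> edges \<Delta> \<Longrightarrow> label \<Delta> e \<in> A"
    using \<Delta> by (auto simp: van_kampen_diagram_def)
  have edge: "\<exists>e'\<in>edges ?X. \<forall>t\<in>{0..1}. \<pi> (e t) = e' t" if e: "e \<in> edges \<Delta>" for e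
  proof -
    obtain g where "g \<in> carrier G" "\<forall>t\<in>{0..1}. \<pi> (e t) = cayley_edge G g (label \<Delta> e) t"
      using \<pi> e unfolding canonical_map_def by blast
    with label[OF e] show ?thesis
      by (intro bexI[of _ "cayley_edge G g (label \<Delta> e)"]) (auto simp: cayley_complex_def)
  qed
  have face: "\<exists>\<Phi>'\<in>faces ?X. \<forall>z\<in>cball 0 1. \<pi> (\<Phi> z) = \<Phi>' z" if \<Phi>: "\<Phi> \<in> faces \<Delta>" for \<Phi>
  proof -
    obtain g r where "g \<in> carrier G" "r \<in> R" "\<forall>z\<in>cball 0 1. \<pi> (\<Phi> z) = cayley_face G g r z"
      using \<pi> \<Phi> unfolding canonical_map_def by blast
    then show ?thesis
      by (intro bexI[of _ "cayley_face G g r"]) (auto simp: cayley_complex_def)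
  qed
  have "\<pi> v \<in> verts ?X" if v: "v \<in> verts \<Delta>" for v
  proof -
    obtain es where es: "edge_path \<Delta> (base \<Delta>) es v"
      using connected_complex_edge_path[OF cc van_kampen_diagram_connected[OF \<Delta>] base v] by blast
    show ?thesis
    proof (cases "es = []")
      case True
      then have "\<pi> v = Vertex \<one>\<^bsub>G\<^esub>"
        using es \<pi> by (simp add: canonical_map_def)
      then show ?thesis
        using G by (simp add: cayley_complex_def group.is_monoid monoid.one_closed)
    next
      case False
      then obtain e where "e \<in> edges \<Delta>" "e 1 = v"
        using edge_path_end[OF es] by blast
      then obtain e' where "e' \<in> edges ?X" "\<pi> v = e' 1"
        using edge[of e] by force
      then show ?thesis
        using complex_edgeD(2)[OF combinatorial_complex_cayley_complex[OF G P]] by simp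
    qed
  qed
  with edge face show ?thesis
    unfolding combinatorial_map_def by blast
qed

section \<open>Monotonicity and values of \<open>j_tilde\<close> and of composites\<close>

lemma mono_j_tilde:
  assumes "mono j" "x \<le> y"
  shows "j_tilde j x \<le> j_tilde j y"
  using monoD[OF assms(1) nat_mono[OF ceiling_mono[OF assms(2)]]] by (simp add: j_tilde_def)

lemma j_tilde_quarter_nats: "j_tilde j x \<in> quarter_nats"
  unfolding quarter_nats_def j_tilde_def
  by (intro range_eqI[of _ _ "4 * (j (nat \<lceil>x\<rceil>) + 1)"]) simp

lemma nondecreasing_quarter_j_tilde:
  assumes "mono j"
  shows "nondecreasing_quarter (j_tilde j)"
  using assms by (auto simp: nondecreasing_quarter_def j_tilde_quarter_nats mono_on_def mono_j_tilde)

lemma nondecreasing_quarter_comp: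
  assumes "nondecreasing_quarter f" "nondecreasing_quarter g"
  shows "nondecreasing_quarter (g \<circ> f)"
  using assms by (auto simp: nondecreasing_quarter_def mono_on_def Pi_iff)

theorem theorem2p2:
  fixes G :: "('g, 'b) monoid_scheme" and A :: "'g set" and R :: "'g list set"
    and D :: "'g list \<Rightarrow> 'g combed_diagram"
    and j :: "nat \<Rightarrow> nat" and f :: "real \<Rightarrow> real"
  assumes "group G"
    and "finite_symmetrized_presentation G A R"
    and "combed_filling G A R D"
    and "mono j"
    and "\<And>w v. w \<in> null_words G A \<Longrightarrow> v \<in> verts (diag (D w)) \<Longrightarrow>
           vdist (diag (D w)) (base (diag (D w))) v
             \<le> j (vdist (cayley_complex G A R) (Vertex \<one>\<^bsub>G\<^esub>) (proj (D w) v))"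
    and "nondecreasing_quarter f"
  shows "(extrinsic_tame_wrt G A R D f \<longrightarrow> intrinsic_tame G A R (j_tilde j \<circ> f)) \<and>
         (intrinsic_tame_wrt G A D f \<longrightarrow> extrinsic_tame G A R (f \<circ> j_tilde j))"
proof -
  define dD where "dD w p = diagram_coarse_dist (diag (D w)) p" for w p
  define dX where "dX w p = cayley_coarse_dist G A R (proj (D w) p)" for w p
  have X: "combinatorial_complex (cayley_complex G A R)"
    using assms(1,2) by (rule combinatorial_complex_cayley_complex)
  have bounds: "dX w p \<le> dD w p \<and> dD w p \<le> j_tilde j (dX w p)
      \<and> dD w p \<in> quarter_nats \<and> dX w p \<in> quarter_nats"
    if w: "w \<in> null_words G A" and p: "p \<in> points (diag (D w))" for w p
  proof -
    let ?\<Delta> = "diag (D w)" and ?\<pi> = "proj (D w)"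
    have vk: "van_kampen_diagram G A R w ?\<Delta>" and cm: "canonical_map G A R ?\<Delta> ?\<pi>"
      using assms(3) w by (auto simp: combed_filling_def)
    have \<Delta>: "combinatorial_complex ?\<Delta>" "connected_space (cw_topology ?\<Delta>)"
      and base: "base ?\<Delta> \<in> verts ?\<Delta>" "?\<pi> (base ?\<Delta>) = Vertex \<one>\<^bsub>G\<^esub>"
      using vk cm van_kampen_diagram_connected[OF vk]
      by (simp_all add: van_kampen_diagram_def canonical_map_def)
    note \<pi> = canonical_map_combinatorial_map[OF assms(1,2) vk cm]
    note facts = combinatorial_map_coarse_dist[OF \<Delta> X \<pi> base(1) p, unfolded base(2)]
    show ?thesis
      using facts(2) facts(3)[OF assms(4) assms(5)[OF w]] coarse_dist_quarter_nats[OF \<Delta>(1) p]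
        coarse_dist_quarter_nats[OF X facts(1)]
      by (simp add: dD_def dX_def diagram_coarse_dist_def cayley_coarse_dist_def)
  qed
  have htpy: "htpy (D w) (p, t) \<in> points (diag (D w))"
    if "w \<in> null_words G A" "p \<in> diagram_boundary (diag (D w))" "0 \<le> t" "t \<le> 1" for w p t
    using assms(3) that unfolding combed_filling_def van_kampen_homotopy_def
    by (meson SigmaI atLeastAtMost_iff image_subset_iff)
  have f: "f x \<le> f y" if "x \<in> quarter_nats" "y \<in> quarter_nats" "x \<le> y" for x y
    using assms(6) that by (auto simp: nondecreasing_quarter_def mono_on_def)
  note j = nondecreasing_quarter_j_tilde[OF assms(4)]
  show ?thesis
  proof (intro conjI impI)
    assume ext: "extrinsic_tame_wrt G A R D f"
    have "dD w (htpy (D w) (p, s)) \<le> j_tilde j (f (dD w (htpy (D w) (p, t))))"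
      if w: "w \<in> null_words G A" and p: "p \<in> diagram_boundary (diag (D w))"
        and st: "0 \<le> s" "s < t" "t \<le> 1" for w p s t
    proof -
      let ?s = "htpy (D w) (p, s)" and ?t = "htpy (D w) (p, t)"
      \<comment> \<open>In short: dD(s) \<le> j_tilde(dX(s)) \<le> j_tilde(f(dX(t))) \<le>
        j_tilde(f(dD(t))), so \<open>j_tilde\<close> ends up outside \<open>f\<close>.\<close>
      have bs: "dD w ?s \<le> j_tilde j (dX w ?s)"
        using bounds[OF w htpy[OF w p]] st by auto
      have bt: "dX w ?t \<le> dD w ?t" "dX w ?t \<in> quarter_nats" "dD w ?t \<in> quarter_nats"
        using bounds[OF w htpy[OF w p]] st by auto
      have "dX w ?s \<le> f (dX w ?t)"
        using ext w p st by (auto simp: extrinsic_tame_wrt_def dX_def)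
      also have "\<dots> \<le> f (dD w ?t)"
        using bt by (intro f)
      finally show ?thesis
        using bs mono_j_tilde[OF assms(4)] order_trans by blast
    qed
    then have "intrinsic_tame_wrt G A D (j_tilde j \<circ> f)"
      using nondecreasing_quarter_comp[OF assms(6) j] by (simp add: intrinsic_tame_wrt_def dD_def)
    with assms(3) show "intrinsic_tame G A R (j_tilde j \<circ> f)"
      unfolding intrinsic_tame_def by blast
  next
    assume int: "intrinsic_tame_wrt G A D f"
    have "dX w (htpy (D w) (p, s)) \<le> f (j_tilde j (dX w (htpy (D w) (p, t))))"
      if w: "w \<in> null_words G A" and p: "p \<in> diagram_boundary (diag (D w))"
        and st: "0 \<le> s" "s < t" "t \<le> 1" for w p s t
    proof -
      let ?s = "htpy (D w) (p, s)" and ?t = "htpy (D w) (p, t)"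
      \<comment> \<open>Here passing to the diagram at \<open>s\<close> costs nothing, and the price
        is paid at \<open>t\<close>, under \<open>f\<close>; hence the reversed order of
        composition.\<close>
      have "dX w ?s \<le> dD w ?s"
        using bounds[OF w htpy[OF w p]] st by auto
      also have "\<dots> \<le> f (dD w ?t)"
        using int w p st by (auto simp: intrinsic_tame_wrt_def dD_def)
      also have "\<dots> \<le> f (j_tilde j (dX w ?t))"
        using bounds[OF w htpy[OF w p]] st by (intro f j_tilde_quarter_nats) auto
      finally show ?thesis .
    qed
    then have "extrinsic_tame_wrt G A R D (f \<circ> j_tilde j)"
      using nondecreasing_quarter_comp[OF j assms(6)] by (simp add: extrinsic_tame_wrt_def dX_def)
    with assms(3) show "extrinsic_tame G A R (f \<circ> j_tilde j)"
      unfolding extrinsic_tame_def by blast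
  qed
qed

end
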